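(* There exists a function $g:\mathbb{N}\to\mathbb{R}_{>0}$ with $g(n)\to\infty$ as $n\to\infty$ such that the following holds: for every positive integer $n$ and every multi-graph $G$ on $n$ vertices such that every set of edges whose removal makes $G$ triangle-free has size at least $n^2$, the number of triangles in $G$ is at least $g(n)\,n^2$. (That is, such $G$ contains $\omega(n^2)$ triangles.)
   Context: A multi-graph on a finite vertex set $V$ is given by assigning to each unordered pair $\{u,v\}$ of distinct vertices a nonnegative integer multiplicity $m(u,v)$, the number of (parallel) edges joining $u$ and $v$; there are no loops, and multiplicities may be arbitrarily large. Triangles are identified with their edge sets: a triangle consists of three distinct vertices $u,v,w$ together with a choice of one edge between each of the pairs $\{u,v\},\{v,w\},\{u,w\}$. Thus the number of triangles of $G$ is $\sum_{\{u,v,w\}} m(u,v)\,m(v,w)\,m(u,w)$, the sum over all 3-element subsets of $V$. Removing edges means deleting individual parallel edges (each deleted edge counts once); $G$ is triangle-free if it contains no triangle. *)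

theory Defs
  imports Complex_Main
begin

text \<open>A multi-graph on the vertex set {0..<n} is given by m :: nat => nat => nat,
  where m u v for u < v is the multiplicity of the pair {u,v}; entries with u >= v
  are ignored by all definitions below.\<close>

definition num_triangles :: "nat \<Rightarrow> (nat \<Rightarrow> nat \<Rightarrow> nat) \<Rightarrow> nat" where
  "num_triangles n m =
     (\<Sum>(u,v,w) \<in> {(u,v,w). u < v \<and> v < w \<and> w < n}. m u v * m v w * m u w)"

definition triangle_free :: "nat \<Rightarrow> (nat \<Rightarrow> nat \<Rightarrow> nat) \<Rightarrow> bool" where
  "triangle_free n m \<longleftrightarrow>
     (\<forall>u v w. u < v \<and> v < w \<and> w < n \<longrightarrow> m u v = 0 \<or> m v w = 0 \<or> m u w = 0)"

definition submultigraph :: "nat \<Rightarrow> (nat \<Rightarrow> nat \<Rightarrow> nat) \<Rightarrow> (nat \<Rightarrow> nat \<Rightarrow> nat) \<Rightarrow> bool" where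
  "submultigraph n h m \<longleftrightarrow> (\<forall>u v. u < v \<and> v < n \<longrightarrow> h u v \<le> m u v)"

definition num_removed :: "nat \<Rightarrow> (nat \<Rightarrow> nat \<Rightarrow> nat) \<Rightarrow> (nat \<Rightarrow> nat \<Rightarrow> nat) \<Rightarrow> nat" where
  "num_removed n m h = (\<Sum>(u,v) \<in> {(u,v). u < v \<and> v < n}. m u v - h u v)"

end

theory Submission
  imports Defs "HOL-Analysis.Convex"
begin

text \<open>
  Take a maximal edge-disjoint family of triangles, encoded as a weight w on vertex triples; the load
  of a pair is the total weight of the triples containing it. Every triangle contains a saturated
  pair, so the total weight is at least n^2/3. If there are fewer than C n^2 triangles, then the sum
  over all triples of the product of their three loads is below C n^2; hence triples of total weight
  above n^2/6 have load product at most 6 C w, and since w is at most each load, their loads are at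
  most 6 C. The triangle removal lemma, applied to the underlying simple graph (which has
  o(n^3) triangles), gives at most n^2/(36 C) pairs hitting all triangles, and these carry too
  little load to account for the weight of those triples.

  The removal lemma comes from Szemeredi's regularity lemma, with partitions given as the atoms of
  a finite family of sets, so that refining a partition means enlarging the family.
\<close>

section \<open>The regularity lemma\<close>

definition dens :: "('a \<Rightarrow> 'a \<Rightarrow> real) \<Rightarrow> 'a set \<Rightarrow> 'a set \<Rightarrow> real" where
  "dens f X Y = (\<Sum>a\<in>X. \<Sum>b\<in>Y. f a b) / (real (card X) * real (card Y))"

definition atom :: "'a set \<Rightarrow> 'a set set \<Rightarrow> 'a \<Rightarrow> 'a set" where
  "atom V S x = {y \<in> V. \<forall>A\<in>S. y \<in> A \<longleftrightarrow> x \<in> A}"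

text \<open>The error is measured relative to the whole rectangle, so no lower bound on the sizes of
  the subsets A and B is needed.\<close>

definition irregular :: "('a \<Rightarrow> 'a \<Rightarrow> real) \<Rightarrow> real \<Rightarrow> 'a set \<Rightarrow> 'a set \<Rightarrow> bool" where
  "irregular f \<epsilon> X Y \<longleftrightarrow> (\<exists>A B. A \<subseteq> X \<and> B \<subseteq> Y \<and>
     \<epsilon> * real (card X) * real (card Y)
       < \<bar>(\<Sum>a\<in>A. \<Sum>b\<in>B. f a b) - dens f X Y * real (card A) * real (card B)\<bar>)"

section \<open>Partitions into atoms and averaging over their rectangles\<close>

lemma atom_subset: "atom V S x \<subseteq> V"
  by (auto simp: atom_def)

lemma finite_atom: "finite V \<Longrightarrow> finite (atom V S x)"
  using atom_subset finite_subset by metis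

lemma self_in_atom: "x \<in> V \<Longrightarrow> x \<in> atom V S x"
  by (auto simp: atom_def)

lemma atom_eq: "y \<in> atom V S x \<Longrightarrow> atom V S y = atom V S x"
  by (auto simp: atom_def)

lemma atom_commute: "x \<in> V \<Longrightarrow> y \<in> V \<Longrightarrow> y \<in> atom V S x \<longleftrightarrow> x \<in> atom V S y"
  by (auto simp: atom_def)

lemma atom_antimono: "S \<subseteq> S' \<Longrightarrow> atom V S' x \<subseteq> atom V S x"
  by (auto simp: atom_def)

lemma card_atom_pos: "finite V \<Longrightarrow> x \<in> V \<Longrightarrow> 0 < card (atom V S x)"
  using finite_atom self_in_atom by (metis card_gt_0_iff empty_iff)

text \<open>An atom is determined by the subfamily of those members of \<open>S\<close> that contain
  it.\<close>

lemma card_atoms_le: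
  assumes "finite S"
  shows "finite (atom V S ` V)" "card (atom V S ` V) \<le> 2 ^ card S"
proof -
  have sub: "atom V S ` V \<subseteq> (\<lambda>T. {y \<in> V. \<forall>A\<in>S. y \<in> A \<longleftrightarrow> A \<in> T}) ` Pow S"
  proof
    fix X assume "X \<in> atom V S ` V"
    then obtain x where "X = atom V S x" by auto
    then have "X = (\<lambda>T. {y \<in> V. \<forall>A\<in>S. y \<in> A \<longleftrightarrow> A \<in> T}) {A\<in>S. x \<in> A}"
      by (auto simp: atom_def)
    then show "X \<in> (\<lambda>T. {y \<in> V. \<forall>A\<in>S. y \<in> A \<longleftrightarrow> A \<in> T}) ` Pow S"
      by blast
  qed
  have fin: "finite (Pow S)" using assms by simp
  show "finite (atom V S ` V)"
    using sub fin finite_subset by blast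
  have "card (atom V S ` V) \<le> card (Pow S)"
    using sub fin by (meson card_image_le card_mono finite_imageI le_trans)
  then show "card (atom V S ` V) \<le> 2 ^ card S"
    by (simp add: card_Pow assms)
qed

text \<open>Averaging over the rectangles of atoms is a self-adjoint projection.\<close>

lemma sum_dens_atoms:
  fixes f g :: "'a \<Rightarrow> 'a \<Rightarrow> real"
  assumes V: "finite V"
    and g: "\<And>x y a b. \<lbrakk>x \<in> V; y \<in> V; a \<in> atom V S x; b \<in> atom V S y\<rbrakk> \<Longrightarrow> g a b = g x y"
  shows "(\<Sum>x\<in>V. \<Sum>y\<in>V. g x y * dens f (atom V S x) (atom V S y))
       = (\<Sum>x\<in>V. \<Sum>y\<in>V. g x y * f x y)"
proof -
  \<comment> \<open>\<open>K\<close> is the kernel of averaging over atoms. It is symmetric on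
    \<open>V\<close> with all row sums 1, so averaging can be shifted from \<open>f\<close> to
    \<open>g\<close>, which it leaves unchanged.\<close>
  define K where "K x a = (if a \<in> atom V S x then 1 / real (card (atom V S x)) else 0)" for x a
  have Ksym: "K x a = K a x" if "x \<in> V" "a \<in> V" for x a
    using that atom_commute[of x V a S] atom_eq[of a V S x] by (auto simp: K_def)
  have Ksum: "(\<Sum>a\<in>V. K x a) = 1" if "x \<in> V" for x
  proof -
    have "(\<Sum>a\<in>V. K x a) = (\<Sum>a\<in>V \<inter> atom V S x. 1 / real (card (atom V S x)))"
      unfolding K_def by (rule sum.inter_restrict[OF V, symmetric])
    also have "V \<inter> atom V S x = atom V S x" using atom_subset[of V S x] by blast
    finally show ?thesis using card_atom_pos[OF V that, of S] by simp
  qed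
  have dens: "dens f (atom V S x) (atom V S y) = (\<Sum>a\<in>V. \<Sum>b\<in>V. K x a * K y b * f a b)" for x y
  proof -
    have "(\<Sum>a\<in>V. \<Sum>b\<in>V. K x a * K y b * f a b)
        = (\<Sum>a\<in>V. if a \<in> atom V S x then \<Sum>b\<in>V. if b \<in> atom V S y then
            f a b / (real (card (atom V S x)) * real (card (atom V S y))) else 0 else 0)"
      by (auto simp: K_def intro!: sum.cong)
    also have "\<dots> = (\<Sum>a\<in>V \<inter> atom V S x. \<Sum>b\<in>V \<inter> atom V S y.
            f a b / (real (card (atom V S x)) * real (card (atom V S y))))"
      by (simp add: sum.inter_restrict V)
    also have "\<dots> = dens f (atom V S x) (atom V S y)"
      using atom_subset[of V S x] atom_subset[of V S y]
      by (simp add: dens_def sum_divide_distrib Int_absorb1)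
    finally show ?thesis by simp
  qed
  \<comment> \<open>Where \<open>K x a * K y b\<close> is nonzero, \<open>a\<close> and
    \<open>b\<close> lie in the atoms of \<open>x\<close> and \<open>y\<close>, so
    \<open>g x y\<close> may be replaced by \<open>g a b\<close>. The sums over \<open>x\<close> and
    \<open>y\<close> are then moved inside, where the kernel factors sum to 1.\<close>
  have "(\<Sum>x\<in>V. \<Sum>y\<in>V. g x y * dens f (atom V S x) (atom V S y))
      = (\<Sum>x\<in>V. \<Sum>y\<in>V. \<Sum>a\<in>V. \<Sum>b\<in>V. g a b * f a b * (K a x * K b y))"
    unfolding dens sum_distrib_left
  proof (intro sum.cong refl)
    fix x y a b assume "x \<in> V" "y \<in> V" "a \<in> V" "b \<in> V"
    then show "g x y * (K x a * K y b * f a b) = g a b * f a b * (K a x * K b y)"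
      using g[of x y a b] Ksym[of x a] Ksym[of y b] by (auto simp: K_def split: if_splits)
  qed
  also have "\<dots> = (\<Sum>x\<in>V. \<Sum>a\<in>V. \<Sum>y\<in>V. \<Sum>b\<in>V. g a b * f a b * (K a x * K b y))"
    by (rule sum.cong[OF refl], rule sum.swap)
  also have "\<dots> = (\<Sum>a\<in>V. \<Sum>x\<in>V. \<Sum>y\<in>V. \<Sum>b\<in>V. g a b * f a b * (K a x * K b y))"
    by (rule sum.swap)
  also have "\<dots> = (\<Sum>a\<in>V. \<Sum>x\<in>V. \<Sum>b\<in>V. \<Sum>y\<in>V. g a b * f a b * (K a x * K b y))"
    by (rule sum.cong[OF refl], rule sum.cong[OF refl], rule sum.swap)
  also have "\<dots> = (\<Sum>a\<in>V. \<Sum>b\<in>V. \<Sum>x\<in>V. \<Sum>y\<in>V. g a b * f a b * (K a x * K b y))"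
    by (rule sum.cong[OF refl], rule sum.swap)
  also have "\<dots> = (\<Sum>a\<in>V. \<Sum>b\<in>V. g a b * f a b)"
  proof (intro sum.cong refl)
    fix a b assume "a \<in> V" "b \<in> V"
    have "(\<Sum>x\<in>V. \<Sum>y\<in>V. g a b * f a b * (K a x * K b y))
        = g a b * f a b * ((\<Sum>x\<in>V. K a x) * (\<Sum>y\<in>V. K b y))"
      unfolding sum_product by (simp add: sum_distrib_left)
    then show "(\<Sum>x\<in>V. \<Sum>y\<in>V. g a b * f a b * (K a x * K b y)) = g a b * f a b"
      using Ksum \<open>a \<in> V\<close> \<open>b \<in> V\<close> by simp
  qed
  finally show ?thesis .
qed

lemma dens_atoms_cong:
  assumes "a \<in> atom V S x" "b \<in> atom V S y"
  shows "dens f (atom V S a) (atom V S b) = dens f (atom V S x) (atom V S y)"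
  using atom_eq[OF assms(1)] atom_eq[OF assms(2)] by simp

text \<open>Squared Euclidean norm of the projection of \<open>f\<close> onto functions constant on
  rectangles of atoms. Summing over vertices weights each rectangle by its area.\<close>

definition energy :: "('a \<Rightarrow> 'a \<Rightarrow> real) \<Rightarrow> 'a set \<Rightarrow> 'a set set \<Rightarrow> real" where
  "energy f V S = (\<Sum>x\<in>V. \<Sum>y\<in>V. (dens f (atom V S x) (atom V S y))\<^sup>2)"

text \<open>The coarse densities are constant on the fine rectangles too, so pairing them with the
  fine densities, with \<open>f\<close>, or with themselves gives the same value.\<close>

lemma energy_pythagoras:
  assumes V: "finite V" and S: "S \<subseteq> S'"
  shows "energy f V S' = energy f V S +
    (\<Sum>x\<in>V. \<Sum>y\<in>V. (dens f (atom V S' x) (atom V S' y) - dens f (atom V S x) (atom V S y))\<^sup>2)"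
proof -
  let ?d = "\<lambda>x y. dens f (atom V S x) (atom V S y)"
  let ?d' = "\<lambda>x y. dens f (atom V S' x) (atom V S' y)"
  have "(\<Sum>x\<in>V. \<Sum>y\<in>V. ?d x y * ?d' x y) = (\<Sum>x\<in>V. \<Sum>y\<in>V. ?d x y * f x y)"
  proof (rule sum_dens_atoms[OF V])
    fix x y a b assume "a \<in> atom V S' x" "b \<in> atom V S' y"
    then show "?d a b = ?d x y"
      using atom_antimono[OF S] by (intro dens_atoms_cong) blast+
  qed
  also have "\<dots> = (\<Sum>x\<in>V. \<Sum>y\<in>V. ?d x y * ?d x y)"
    by (rule sum_dens_atoms[OF V, symmetric]) (rule dens_atoms_cong)
  finally have eq: "(\<Sum>x\<in>V. \<Sum>y\<in>V. ?d x y * ?d' x y) = energy f V S"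
    by (simp add: energy_def power2_eq_square)
  have "(\<Sum>x\<in>V. \<Sum>y\<in>V. (?d' x y - ?d x y)\<^sup>2)
      = energy f V S' + energy f V S - 2 * (\<Sum>x\<in>V. \<Sum>y\<in>V. ?d x y * ?d' x y)"
    by (simp add: energy_def power2_diff sum.distrib sum_subtractf sum_distrib_left mult_ac)
  then show ?thesis using eq by simp
qed

lemma dens_bounds:
  assumes "\<And>x y. 0 \<le> f x y" "\<And>x y. f x y \<le> 1"
  shows "0 \<le> dens f X Y" "dens f X Y \<le> 1"
proof -
  show "0 \<le> dens f X Y"
    unfolding dens_def by (intro divide_nonneg_nonneg sum_nonneg assms) auto
  have "(\<Sum>a\<in>X. \<Sum>b\<in>Y. f a b) \<le> (\<Sum>a\<in>X. \<Sum>b\<in>Y. 1)"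
    by (intro sum_mono assms)
  then have "(\<Sum>a\<in>X. \<Sum>b\<in>Y. f a b) \<le> real (card X) * real (card Y)" by simp
  then show "dens f X Y \<le> 1"
    unfolding dens_def by (intro divide_le_eq_1[THEN iffD2])
      (metis linorder_not_less mult_nonneg_nonneg of_nat_0_le_iff order_le_less)
qed

lemma energy_le:
  assumes "\<And>x y. 0 \<le> f x y" "\<And>x y. f x y \<le> 1"
  shows "energy f V S \<le> (real (card V))\<^sup>2"
proof -
  have "energy f V S \<le> (\<Sum>x\<in>V. \<Sum>y\<in>V. 1)"
    unfolding energy_def using dens_bounds[of f] assms
    by (intro sum_mono) (simp add: power_le_one)
  then show ?thesis by (simp add: power2_eq_square)
qed

text \<open>Enlarging \<open>S\<close> by two witness sets for every pair of atoms makes each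
  discrepancy visible in the refined densities. On an irregular rectangle they then differ from the
  old density by at least \<open>\<epsilon>\<^sup>2\<close> in mean square, and the Pythagorean
  identity turns this into energy. There are at most \<open>4 ^ card S\<close> pairs of
  atoms.\<close>

lemma energy_increment:
  fixes f :: "'a \<Rightarrow> 'a \<Rightarrow> real"
  assumes V: "finite V" and S: "finite S" and eps: "0 < \<epsilon>"
  obtains S' where "finite S'" "S \<subseteq> S'" "card S' \<le> card S + 2 * 4 ^ card S"
    "energy f V S + \<epsilon>\<^sup>2 * real (card {(x, y) \<in> V \<times> V. irregular f \<epsilon> (atom V S x) (atom V S y)})
      \<le> energy f V S'"
proof -
  let ?at = "atom V S"
  let ?At = "?at ` V"
  define W where "W X Y A B \<longleftrightarrow> A \<subseteq> X \<and> B \<subseteq> Y \<and>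
     \<epsilon> * real (card X) * real (card Y)
       < \<bar>(\<Sum>a\<in>A. \<Sum>b\<in>B. f a b) - dens f X Y * real (card A) * real (card B)\<bar>" for X Y A B
  have "\<exists>A B. W X Y A B" if "irregular f \<epsilon> X Y" for X Y
    using that by (simp add: irregular_def W_def)
  \<comment> \<open>Witnesses are chosen per pair of atoms, not per pair of vertices, which bounds
    the number of new sets in terms of \<open>card S\<close> alone.\<close>
  then obtain A B where AB: "\<And>X Y. irregular f \<epsilon> X Y \<Longrightarrow> W X Y (A X Y) (B X Y)"
    by metis
  define S' where "S' = S \<union> (case_prod A ` (?At \<times> ?At) \<union> case_prod B ` (?At \<times> ?At))"
  have SS': "S \<subseteq> S'" by (auto simp: S'_def)
  have finAt: "finite (?At \<times> ?At)" using card_atoms_le[OF S] by blast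
  have "card (?At \<times> ?At) \<le> 2 ^ card S * 2 ^ card S"
    unfolding card_cartesian_product using card_atoms_le[OF S, of V] by (intro mult_mono) auto
  also have "\<dots> = (4::nat) ^ card S" by (simp flip: power_mult_distrib)
  finally have c4: "card (?At \<times> ?At) \<le> 4 ^ card S" .
  have finS': "finite S'" using S finAt by (simp add: S'_def)
  have "card S' \<le> card S + (card (case_prod A ` (?At \<times> ?At)) + card (case_prod B ` (?At \<times> ?At)))"
    unfolding S'_def by (meson add_left_mono card_Un_le le_trans)
  also have "\<dots> \<le> card S + (4 ^ card S + 4 ^ card S)"
    using c4 finAt by (intro add_mono order_refl) (meson card_image_le le_trans)+
  finally have cardS': "card S' \<le> card S + 2 * 4 ^ card S" by simp
  let ?d = "\<lambda>x y. dens f (?at x) (?at y)"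
  let ?d' = "\<lambda>x y. dens f (atom V S' x) (atom V S' y)"
  let ?h = "\<lambda>x y. (?d' x y - ?d x y)\<^sup>2"
  let ?I = "\<lambda>x y. if irregular f \<epsilon> (?at x) (?at y) then 1 else (0::real)"
  have key: "\<epsilon>\<^sup>2 \<le> dens ?h (?at x) (?at y)"
    if x: "x \<in> V" and y: "y \<in> V" and irr: "irregular f \<epsilon> (?at x) (?at y)" for x y
  proof -
    define X Y where "X = ?at x" and "Y = ?at y"
    define P Q where "P = A X Y" and "Q = B X Y"
    have PQ: "P \<subseteq> X" "Q \<subseteq> Y"
      and big: "\<epsilon> * real (card X) * real (card Y)
       < \<bar>(\<Sum>a\<in>P. \<Sum>b\<in>Q. f a b) - dens f X Y * real (card P) * real (card Q)\<bar>"
      using AB[OF irr] unfolding W_def X_def[symmetric] Y_def[symmetric] P_def[symmetric] Q_def[symmetric]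
      by blast+
    have XV: "X \<subseteq> V" "Y \<subseteq> V" by (simp_all add: X_def Y_def atom_subset)
    then have fin: "finite X" "finite Y" "finite P" "finite Q"
      using V PQ by (meson finite_subset)+
    have PQV: "P \<subseteq> V" "Q \<subseteq> V" using PQ XV by auto
    have mem: "P \<in> S'" "Q \<in> S'" using x y by (auto simp: S'_def P_def Q_def X_def Y_def)
    have pos: "0 < real (card X)" "0 < real (card Y)"
      using card_atom_pos[OF V] x y by (simp_all add: X_def Y_def)
    have restr: "(\<Sum>a\<in>P. \<Sum>b\<in>Q. u a b)
        = (\<Sum>a\<in>V. \<Sum>b\<in>V. (if a \<in> P \<and> b \<in> Q then 1 else 0) * u a b)" for u :: "'a \<Rightarrow> 'a \<Rightarrow> real"
    proof -
      have "(\<Sum>a\<in>V. \<Sum>b\<in>V. (if a \<in> P \<and> b \<in> Q then 1 else 0) * u a b)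
          = (\<Sum>a\<in>V. if a \<in> P then \<Sum>b\<in>V. if b \<in> Q then u a b else 0 else 0)"
        by (auto intro!: sum.cong)
      also have "\<dots> = (\<Sum>a\<in>V \<inter> P. \<Sum>b\<in>V \<inter> Q. u a b)"
        by (simp add: sum.inter_restrict V)
      finally show ?thesis using PQV by (simp add: Int_absorb1)
    qed
    \<comment> \<open>\<open>P\<close> and \<open>Q\<close> belong to \<open>S'\<close>, hence are
      unions of atoms of \<open>S'\<close>, and averaging over the refined rectangles does not
      change the sum over \<open>P \<times> Q\<close>.\<close>
    have "(\<Sum>a\<in>P. \<Sum>b\<in>Q. ?d' a b) = (\<Sum>a\<in>P. \<Sum>b\<in>Q. f a b)"
      unfolding restr
    proof (rule sum_dens_atoms[OF V])
      fix x y a b assume "a \<in> atom V S' x" "b \<in> atom V S' y"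
      then have "a \<in> P \<longleftrightarrow> x \<in> P" "b \<in> Q \<longleftrightarrow> y \<in> Q"
        using mem by (auto simp: atom_def)
      then show "(if a \<in> P \<and> b \<in> Q then 1 else 0) = (if x \<in> P \<and> y \<in> Q then 1 else (0::real))"
        by simp
    qed
    moreover have "(\<Sum>a\<in>P. \<Sum>b\<in>Q. ?d a b) = (\<Sum>a\<in>P. \<Sum>b\<in>Q. dens f X Y)"
      using PQ dens_atoms_cong[of _ V S x _ y f]
      by (intro sum.cong refl) (auto simp: X_def Y_def)
    ultimately have eq: "(\<Sum>a\<in>P. \<Sum>b\<in>Q. f a b) - dens f X Y * real (card P) * real (card Q)
        = (\<Sum>(a,b)\<in>P \<times> Q. ?d' a b - ?d a b)"
      by (simp add: sum_subtractf mult_ac flip: sum.cartesian_product)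
    \<comment> \<open>Cauchy-Schwarz on \<open>P \<times> Q\<close>. Both factors are then enlarged
      to \<open>X \<times> Y\<close>, which matches the error being measured against the whole
      rectangle.\<close>
    have "(\<epsilon> * real (card X) * real (card Y))\<^sup>2 \<le> (\<Sum>(a,b)\<in>P \<times> Q. ?d' a b - ?d a b)\<^sup>2"
      unfolding abs_le_square_iff[symmetric] eq[symmetric] using big eps by simp
    also have "\<dots> \<le> real (card (P \<times> Q)) * (\<Sum>(a,b)\<in>P \<times> Q. ?h a b)"
      using sum_squared_le_sum_of_squares[of "\<lambda>(a,b). ?d' a b - ?d a b" "P \<times> Q"]
      by (simp add: case_prod_unfold mult_ac)
    also have "\<dots> \<le> real (card (X \<times> Y)) * (\<Sum>(a,b)\<in>X \<times> Y. ?h a b)"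
    proof (rule mult_mono)
      show "real (card (P \<times> Q)) \<le> real (card (X \<times> Y))"
        using PQ fin by (intro of_nat_mono card_mono) auto
      show "(\<Sum>(a,b)\<in>P \<times> Q. ?h a b) \<le> (\<Sum>(a,b)\<in>X \<times> Y. ?h a b)"
        using PQ fin by (intro sum_mono2) auto
    qed (auto intro: sum_nonneg)
    also have "\<dots> = dens ?h X Y * (real (card X) * real (card Y))\<^sup>2"
      using pos by (simp add: dens_def power2_eq_square card_cartesian_product
          flip: sum.cartesian_product)
    finally have "\<epsilon>\<^sup>2 * (real (card X) * real (card Y))\<^sup>2
        \<le> dens ?h X Y * (real (card X) * real (card Y))\<^sup>2"
      by (simp add: power_mult_distrib mult_ac)
    then show ?thesis using pos by (simp add: X_def Y_def)
  qed
  have "\<epsilon>\<^sup>2 * real (card {(x, y) \<in> V \<times> V. irregular f \<epsilon> (?at x) (?at y)})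
      = (\<Sum>(x,y)\<in>V \<times> V. ?I x y * \<epsilon>\<^sup>2)"
  proof -
    have "(\<Sum>(x,y)\<in>V \<times> V. ?I x y * \<epsilon>\<^sup>2)
        = (\<Sum>p\<in>V \<times> V. if p \<in> {(x, y). irregular f \<epsilon> (?at x) (?at y)} then \<epsilon>\<^sup>2 else 0)"
      by (auto intro!: sum.cong)
    also have "\<dots> = (\<Sum>p\<in>V \<times> V \<inter> {(x, y). irregular f \<epsilon> (?at x) (?at y)}. \<epsilon>\<^sup>2)"
      using V by (subst sum.inter_restrict) auto
    also have "V \<times> V \<inter> {(x, y). irregular f \<epsilon> (?at x) (?at y)}
        = {(x, y) \<in> V \<times> V. irregular f \<epsilon> (?at x) (?at y)}" by auto
    finally show ?thesis by simp
  qed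
  also have "\<dots> = (\<Sum>x\<in>V. \<Sum>y\<in>V. ?I x y * \<epsilon>\<^sup>2)"
    by (simp only: sum.cartesian_product)
  also have "\<dots> \<le> (\<Sum>x\<in>V. \<Sum>y\<in>V. ?I x y * dens ?h (?at x) (?at y))"
    using key by (intro sum_mono) auto
  \<comment> \<open>Irregularity depends only on the two atoms, so the averaging of
    \<open>?h\<close> can be undone under the indicator \<open>?I\<close>.\<close>
  also have "\<dots> = (\<Sum>x\<in>V. \<Sum>y\<in>V. ?I x y * ?h x y)"
    by (rule sum_dens_atoms[OF V]) (use atom_eq in metis)
  also have "\<dots> \<le> (\<Sum>x\<in>V. \<Sum>y\<in>V. ?h x y)"
    by (intro sum_mono) auto
  finally have "energy f V S
      + \<epsilon>\<^sup>2 * real (card {(x, y) \<in> V \<times> V. irregular f \<epsilon> (?at x) (?at y)}) \<le> energy f V S'"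
    using energy_pythagoras[OF V SS', of f] by simp
  with finS' SS' cardS' show thesis by (rule that)
qed

text \<open>Iterates the growth of \<open>card S\<close> in \<open>energy_increment\<close>,
  starting from the empty family; the growth is of tower type.\<close>

fun regularity_bound :: "nat \<Rightarrow> nat" where
  "regularity_bound 0 = 0"
| "regularity_bound (Suc i) = regularity_bound i + 2 * 4 ^ regularity_bound i"

lemma regularity_bound_mono: "i \<le> j \<Longrightarrow> regularity_bound i \<le> regularity_bound j"
  by (rule lift_Suc_mono_le) simp_all

text \<open>As long as too many pairs are irregular, each refinement adds at least
  \<open>\<epsilon> ^ 3 * (real (card V))\<^sup>2\<close> to the energy, which never exceeds
  \<open>(real (card V))\<^sup>2\<close>. The number of rounds, and with it \<open>K\<close>,
  therefore depends on \<open>\<epsilon>\<close> only.\<close>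

theorem regularity_lemma:
  assumes eps: "0 < \<epsilon>"
  shows "\<exists>K. \<forall>(V :: 'a set) f. finite V \<and> (\<forall>x y. 0 \<le> f x y \<and> f x y \<le> 1) \<longrightarrow>
    (\<exists>S. finite S \<and> card S \<le> K \<and>
      real (card {(x, y) \<in> V \<times> V. irregular f \<epsilon> (atom V S x) (atom V S y)}) \<le> \<epsilon> * (real (card V))\<^sup>2)"
proof -
  obtain N :: nat where N: "1 / \<epsilon> ^ 3 < real N" using reals_Archimedean2 by blast
  have "\<exists>S. finite S \<and> card S \<le> regularity_bound N \<and>
      real (card {(x, y) \<in> V \<times> V. irregular f \<epsilon> (atom V S x) (atom V S y)}) \<le> \<epsilon> * (real (card V))\<^sup>2"
    if V: "finite V" and f: "\<And>x y. 0 \<le> f x y" "\<And>x y. f x y \<le> 1"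
    for V :: "'a set" and f
  proof (rule ccontr)
    let ?irr = "\<lambda>S. real (card {(x, y) \<in> V \<times> V. irregular f \<epsilon> (atom V S x) (atom V S y)})"
    assume neg: "\<not> (\<exists>S. finite S \<and> card S \<le> regularity_bound N \<and> ?irr S \<le> \<epsilon> * (real (card V))\<^sup>2)"
    have "\<exists>S. finite S \<and> card S \<le> regularity_bound i \<and>
        real i * \<epsilon> ^ 3 * (real (card V))\<^sup>2 \<le> energy f V S" if "i \<le> N" for i
      using that
    proof (induction i)
      case 0
      show ?case by (rule exI[of _ "{}"]) (simp add: energy_def sum_nonneg)
    next
      case (Suc i)
      then obtain S where S: "finite S" "card S \<le> regularity_bound i"
        "real i * \<epsilon> ^ 3 * (real (card V))\<^sup>2 \<le> energy f V S" by auto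
      have "card S \<le> regularity_bound N"
        using S(2) Suc.prems regularity_bound_mono[of i N] by simp
      with neg S(1) have irr: "\<epsilon> * (real (card V))\<^sup>2 \<le> ?irr S" by force
      obtain S' where S': "finite S'" "S \<subseteq> S'" "card S' \<le> card S + 2 * 4 ^ card S"
        "energy f V S + \<epsilon>\<^sup>2 * ?irr S \<le> energy f V S'"
        by (rule energy_increment[OF V S(1) eps])
      have "\<epsilon>\<^sup>2 * (\<epsilon> * (real (card V))\<^sup>2) \<le> \<epsilon>\<^sup>2 * ?irr S"
        by (intro mult_left_mono irr) simp
      then have "real (Suc i) * \<epsilon> ^ 3 * (real (card V))\<^sup>2 \<le> energy f V S'"
        using S(3) S'(4) by (simp add: algebra_simps power2_eq_square power3_eq_cube)
      moreover have "(4::nat) ^ card S \<le> 4 ^ regularity_bound i"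
        using S(2) by (intro power_increasing) auto
      then have "card S' \<le> regularity_bound (Suc i)"
        unfolding regularity_bound.simps using S'(3) S(2) by linarith
      ultimately show ?case using S'(1) by blast
    qed
    then obtain S where S: "real N * \<epsilon> ^ 3 * (real (card V))\<^sup>2 \<le> energy f V S" by blast
    \<comment> \<open>The final contradiction is a strict inequality between multiples of
      \<open>(real (card V))\<^sup>2\<close>, so this square must be positive. For empty
      \<open>V\<close> the family \<open>{}\<close> already qualifies.\<close>
    have "V \<noteq> {}"
    proof
      assume "V = {}"
      then have "finite {} \<and> card {} \<le> regularity_bound N \<and> ?irr {} \<le> \<epsilon> * (real (card V))\<^sup>2"
        by simp
      with neg show False by blast
    qed
    then have "0 < (real (card V))\<^sup>2" using V by (simp add: card_gt_0_iff)
    moreover have "1 < real N * \<epsilon> ^ 3" using N eps by (simp add: field_simps)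
    ultimately have "(real (card V))\<^sup>2 < real N * \<epsilon> ^ 3 * (real (card V))\<^sup>2" by simp
    then show False using S energy_le[of f V S] f by simp
  qed
  then show ?thesis
    by (intro exI[of _ "regularity_bound N"] allI impI) auto
qed

section \<open>Triangle removal\<close>

text \<open>Regularity is tested on the low-degree set \<open>B\<close> against all of
  \<open>Y\<close>. Each vertex of \<open>B\<close> falls short of the degree predicted by the
  density by at least \<open>\<tau> * real (card Y)\<close>, so an error of
  \<open>\<tau> ^ 3\<close> leaves room for a fraction of at most \<open>\<tau>\<^sup>2\<close>,
  hence 1/4, of \<open>X\<close>.\<close>

lemma few_low_degree:
  fixes f :: "'a \<Rightarrow> 'a \<Rightarrow> real"
  assumes fin: "finite X" "finite Y" "Y \<noteq> {}" and \<tau>: "0 < \<tau>" "\<tau> \<le> 1 / 2"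
    and reg: "\<not> irregular f (\<tau> ^ 3) X Y" and dens: "2 * \<tau> \<le> dens f X Y"
  shows "real (card {x \<in> X. (\<Sum>y\<in>Y. f x y) < \<tau> * real (card Y)}) \<le> real (card X) / 4"
proof -
  define B where "B = {x \<in> X. (\<Sum>y\<in>Y. f x y) < \<tau> * real (card Y)}"
  have "B \<subseteq> X" by (auto simp: B_def)
  with reg have "\<bar>(\<Sum>a\<in>B. \<Sum>b\<in>Y. f a b) - dens f X Y * real (card B) * real (card Y)\<bar>
      \<le> \<tau> ^ 3 * real (card X) * real (card Y)"
    unfolding irregular_def using linorder_not_less by blast
  moreover have "(\<Sum>a\<in>B. \<Sum>b\<in>Y. f a b) \<le> (\<Sum>a\<in>B. \<tau> * real (card Y))"
    by (rule sum_mono) (simp add: B_def)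
  moreover have "2 * \<tau> * (real (card B) * real (card Y)) \<le> dens f X Y * (real (card B) * real (card Y))"
    by (rule mult_right_mono[OF dens]) simp
  ultimately have "(\<tau> * real (card B)) * real (card Y) \<le> (\<tau> ^ 3 * real (card X)) * real (card Y)"
    by (simp add: algebra_simps)
  moreover have "0 < real (card Y)" using fin by (simp add: card_gt_0_iff)
  ultimately have "\<tau> * real (card B) \<le> \<tau> ^ 3 * real (card X)" by simp
  then have "\<tau> * real (card B) \<le> \<tau> * (\<tau>\<^sup>2 * real (card X))"
    by (simp add: power2_eq_square power3_eq_cube mult_ac)
  then have "real (card B) \<le> \<tau>\<^sup>2 * real (card X)" using \<tau> by simp
  also have "\<tau>\<^sup>2 \<le> (1 / 2)\<^sup>2" using \<tau> by (intro power_mono) auto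
  then have "\<tau>\<^sup>2 * real (card X) \<le> (1 / 2)\<^sup>2 * real (card X)" by (rule mult_right_mono) simp
  finally show ?thesis by (simp add: B_def power2_eq_square)
qed

lemma sum_of_bool_card:
  assumes "finite P" "finite Q"
  shows "(\<Sum>y\<in>P. \<Sum>z\<in>Q. of_bool ((y, z) \<in> E)) = real (card {(y, z) \<in> P \<times> Q. (y, z) \<in> E})"
proof -
  have "(\<Sum>y\<in>P. \<Sum>z\<in>Q. of_bool ((y, z) \<in> E)) = (\<Sum>p\<in>P \<times> Q. if p \<in> E then 1 else (0::real))"
    by (auto simp: sum.cartesian_product intro!: sum.cong)
  also have "\<dots> = (\<Sum>p\<in>P \<times> Q \<inter> E. 1)"
    using assms by (subst sum.inter_restrict) auto
  also have "P \<times> Q \<inter> E = {(y, z) \<in> P \<times> Q. (y, z) \<in> E}" by auto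
  finally show ?thesis by simp
qed

text \<open>At least half of \<open>X\<close> has large degree into both \<open>Y\<close> and
  \<open>Z\<close>. For such a vertex, regularity of \<open>Y\<close> and \<open>Z\<close>, tested
  on its two neighbourhoods, yields many edges between them, and each closes a triangle.\<close>

lemma triangle_counting:
  fixes E :: "('a \<times> 'a) set"
  defines "f \<equiv> \<lambda>x y. of_bool ((x, y) \<in> E)"
  assumes fin: "finite X" "finite Y" "finite Z" and ne: "Y \<noteq> {}" "Z \<noteq> {}"
    and \<tau>: "0 < \<tau>" "\<tau> \<le> 1 / 2"
    and reg: "\<not> irregular f (\<tau> ^ 3) X Y" "\<not> irregular f (\<tau> ^ 3) X Z" "\<not> irregular f (\<tau> ^ 3) Y Z"
    and dens: "2 * \<tau> \<le> dens f X Y" "2 * \<tau> \<le> dens f X Z" "2 * \<tau> \<le> dens f Y Z"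
  shows "\<tau> ^ 3 / 2 * real (card X) * real (card Y) * real (card Z)
    \<le> real (card {(x, y, z) \<in> X \<times> Y \<times> Z. (x, y) \<in> E \<and> (x, z) \<in> E \<and> (y, z) \<in> E})"
proof -
  define N where "N A x = {y \<in> A. (x, y) \<in> E}" for A x
  define B where "B A = {x \<in> X. (\<Sum>y\<in>A. f x y) < \<tau> * real (card A)}" for A
  define G where "G = X - (B Y \<union> B Z)"
  have deg: "(\<Sum>y\<in>A. f x y) = real (card (N A x))" if "finite A" for A x
    using that by (simp add: f_def N_def Int_def)
  have finN: "finite (N A x)" if "finite A" for A x using that by (simp add: N_def)
  have "real (card (B Y)) \<le> real (card X) / 4" "real (card (B Z)) \<le> real (card X) / 4"
    unfolding B_def using few_low_degree fin ne \<tau> reg dens by blast+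
  moreover have "card (B Y \<union> B Z) \<le> card (B Y) + card (B Z)" by (rule card_Un_le)
  moreover have "card G + card (B Y \<union> B Z) = card X"
  proof -
    have "B Y \<union> B Z \<subseteq> X" by (auto simp: B_def)
    then show ?thesis unfolding G_def using fin
      by (metis add.commute card_Diff_subset card_mono finite_subset le_add_diff_inverse)
  qed
  ultimately have G: "real (card X) / 2 \<le> real (card G)" by linarith
  \<comment> \<open>The neighbourhoods span at least a \<open>\<tau>\<^sup>2\<close> fraction of
    \<open>Y \<times> Z\<close>. Density \<open>2 * \<tau>\<close> predicts
    \<open>2 * \<tau> ^ 3\<close> of the area, and the regularity error takes away at most
    \<open>\<tau> ^ 3\<close>.\<close>
  have loc: "\<tau> ^ 3 * (real (card Y) * real (card Z))
      \<le> real (card {(y, z) \<in> N Y x \<times> N Z x. (y, z) \<in> E})" if "x \<in> G" for x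
  proof -
    have "\<tau> * real (card Y) \<le> real (card (N Y x))" "\<tau> * real (card Z) \<le> real (card (N Z x))"
      using that deg fin by (auto simp: G_def B_def not_less)
    then have "(\<tau> * real (card Y)) * (\<tau> * real (card Z)) \<le> real (card (N Y x)) * real (card (N Z x))"
      using \<tau> by (intro mult_mono) auto
    then have "(2 * \<tau>) * ((\<tau> * real (card Y)) * (\<tau> * real (card Z)))
        \<le> dens f Y Z * (real (card (N Y x)) * real (card (N Z x)))"
      by (rule mult_mono[OF dens(3)]) (use \<tau> dens(3) in auto)
    moreover have "N Y x \<subseteq> Y" "N Z x \<subseteq> Z" by (auto simp: N_def)
    with reg(3) have "\<bar>(\<Sum>a\<in>N Y x. \<Sum>b\<in>N Z x. f a b)
        - dens f Y Z * real (card (N Y x)) * real (card (N Z x))\<bar>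
        \<le> \<tau> ^ 3 * real (card Y) * real (card Z)"
      unfolding irregular_def using linorder_not_less by blast
    moreover have "(\<Sum>a\<in>N Y x. \<Sum>b\<in>N Z x. f a b) = real (card {(y, z) \<in> N Y x \<times> N Z x. (y, z) \<in> E})"
      unfolding f_def by (rule sum_of_bool_card) (simp_all add: finN fin)
    ultimately show ?thesis by (simp add: power3_eq_cube algebra_simps)
  qed
  have "\<tau> ^ 3 / 2 * real (card X) * real (card Y) * real (card Z)
      = (real (card X) / 2) * (\<tau> ^ 3 * (real (card Y) * real (card Z)))"
    by simp
  also have "\<dots> \<le> real (card G) * (\<tau> ^ 3 * (real (card Y) * real (card Z)))"
    using \<tau> by (intro mult_right_mono G) auto
  also have "\<dots> \<le> (\<Sum>x\<in>G. real (card {(y, z) \<in> N Y x \<times> N Z x. (y, z) \<in> E}))"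
    using sum_mono[of G "\<lambda>_. \<tau> ^ 3 * (real (card Y) * real (card Z))", OF loc] by simp
  also have "\<dots> \<le> (\<Sum>x\<in>X. real (card {(y, z) \<in> N Y x \<times> N Z x. (y, z) \<in> E}))"
    using fin by (intro sum_mono2) (auto simp: G_def)
  also have "\<dots> = real (card (SIGMA x:X. {(y, z) \<in> N Y x \<times> N Z x. (y, z) \<in> E}))"
  proof (subst card_SigmaI)
    have "{(y, z) \<in> N Y x \<times> N Z x. (y, z) \<in> E} \<subseteq> N Y x \<times> N Z x" for x by auto
    then show "\<forall>x\<in>X. finite {(y, z) \<in> N Y x \<times> N Z x. (y, z) \<in> E}"
      using finN fin by (meson finite_SigmaI finite_subset)
  qed (use fin in auto)
  also have "(SIGMA x:X. {(y, z) \<in> N Y x \<times> N Z x. (y, z) \<in> E})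
      = {(x, y, z) \<in> X \<times> Y \<times> Z. (x, y) \<in> E \<and> (x, z) \<in> E \<and> (y, z) \<in> E}"
    by (auto simp: N_def)
  finally show ?thesis .
qed

text \<open>There are at most \<open>2 ^ card S\<close> atoms, and each small one contributes fewer
  than \<open>t\<close> vertices.\<close>

lemma card_small_atoms_le:
  assumes V: "finite V" and S: "finite S" and t: "0 \<le> t"
  shows "real (card {x \<in> V. real (card (atom V S x)) < t}) \<le> 2 ^ card S * t"
proof -
  let ?T = "{X \<in> atom V S ` V. real (card X) < t}"
  have finT: "finite ?T" using V by simp
  have "{x \<in> V. real (card (atom V S x)) < t} \<subseteq> \<Union>?T"
    using self_in_atom by fastforce
  moreover have "finite (\<Union>?T)" using V by (auto intro: finite_atom)
  ultimately have "card {x \<in> V. real (card (atom V S x)) < t} \<le> card (\<Union>?T)"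
    by (rule card_mono[rotated])
  also have "\<dots> \<le> (\<Sum>X\<in>?T. card X)"
    using finT card_UN_le[of ?T id] by simp
  finally have "real (card {x \<in> V. real (card (atom V S x)) < t}) \<le> (\<Sum>X\<in>?T. real (card X))"
    by (simp flip: of_nat_sum)
  also have "\<dots> \<le> real (card ?T) * t"
    using sum_mono[of ?T "\<lambda>X. real (card X)" "\<lambda>_. t"] by simp
  also have "\<dots> \<le> 2 ^ card S * t"
  proof (rule mult_right_mono[OF _ t])
    have "card ?T \<le> card (atom V S ` V)" using V by (intro card_mono) auto
    also have "\<dots> \<le> 2 ^ card S" by (rule card_atoms_le[OF S])
    finally show "real (card ?T) \<le> 2 ^ card S"
      using of_nat_mono[where 'a = real] by fastforce
  qed
  finally show ?thesis .
qed

text \<open>Delete the edges lying in irregular or sparse rectangles or meeting small atoms. A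
  surviving triangle would lie in three large atoms that are pairwise regular and dense, and these
  already contain too many triangles. Since \<open>E\<close> consists of ordered pairs, the result
  applies directly to pairs listed in increasing order.\<close>

theorem triangle_removal:
  assumes eps: "0 < \<epsilon>"
  shows "\<exists>\<delta>>0. \<forall>(V :: 'a set) E. finite V \<and>
       real (card {(x, y, z) \<in> V \<times> V \<times> V. (x, y) \<in> E \<and> (x, z) \<in> E \<and> (y, z) \<in> E})
         < \<delta> * real (card V) ^ 3 \<longrightarrow>
     (\<exists>D. D \<subseteq> E \<inter> V \<times> V \<and> real (card D) \<le> \<epsilon> * (real (card V))\<^sup>2 \<and>
       (\<forall>x\<in>V. \<forall>y\<in>V. \<forall>z\<in>V. (x, y) \<in> E \<and> (x, z) \<in> E \<and> (y, z) \<in> E \<longrightarrow>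
          (x, y) \<in> D \<or> (x, z) \<in> D \<or> (y, z) \<in> D))"
proof -
  \<comment> \<open>The deletion budget is \<open>\<tau>\<close> for irregular rectangles,
    \<open>2 * \<tau>\<close> for sparse ones, and \<open>\<tau>\<close> for each of the two
    endpoints in a small atom: \<open>5 * \<tau>\<close> in total.\<close>
  define \<tau> where "\<tau> = min (1 / 2) (\<epsilon> / 5)"
  have \<tau>: "0 < \<tau>" "\<tau> \<le> 1 / 2" "5 * \<tau> \<le> \<epsilon>" using eps by (auto simp: \<tau>_def)
  have "0 < \<tau> ^ 3" using \<tau> by simp
  from regularity_lemma[OF this, where 'a = 'a] obtain K where
    K: "\<forall>(V :: 'a set) f. finite V \<and> (\<forall>x y. 0 \<le> f x y \<and> f x y \<le> 1) \<longrightarrow>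
    (\<exists>S. finite S \<and> card S \<le> K \<and>
      real (card {(x, y) \<in> V \<times> V. irregular f (\<tau> ^ 3) (atom V S x) (atom V S y)})
        \<le> \<tau> ^ 3 * (real (card V))\<^sup>2)"
    by (rule exE)
  \<comment> \<open>With this threshold, the at most \<open>2 ^ K\<close> small atoms together cover
    at most a \<open>\<tau>\<close> fraction of the vertices.\<close>
  define \<eta> where "\<eta> = \<tau> / 2 ^ K"
  have \<eta>: "0 < \<eta>" using \<tau> by (simp add: \<eta>_def)
  show ?thesis
  \<comment> \<open>The witness is the constant that \<open>triangle_counting\<close> gives for
    three atoms of the least allowed size \<open>\<eta> * n\<close>.\<close>
  proof (intro exI[of _ "\<tau> ^ 3 / 2 * \<eta> ^ 3"] conjI allI impI; (elim conjE)?)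
    show "0 < \<tau> ^ 3 / 2 * \<eta> ^ 3" using \<tau> \<eta> by simp
    fix V :: "'a set" and E :: "('a \<times> 'a) set"
    assume V: "finite V" and few: "real (card {(x, y, z) \<in> V \<times> V \<times> V. (x, y) \<in> E \<and> (x, z) \<in> E \<and> (y, z) \<in> E})
         < \<tau> ^ 3 / 2 * \<eta> ^ 3 * real (card V) ^ 3"
    define n where "n = real (card V)"
    define f :: "'a \<Rightarrow> 'a \<Rightarrow> real" where "f = (\<lambda>x y. of_bool ((x, y) \<in> E))"
    obtain S where S: "finite S" "card S \<le> K"
      "real (card {(x, y) \<in> V \<times> V. irregular f (\<tau> ^ 3) (atom V S x) (atom V S y)}) \<le> \<tau> ^ 3 * n\<^sup>2"
      using K[rule_format, of V f] V by (auto simp: f_def n_def)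
    let ?at = "atom V S"
    define small where "small = {x \<in> V. real (card (?at x)) < \<eta> * n}"
    define irr where "irr = {(x, y) \<in> V \<times> V. irregular f (\<tau> ^ 3) (?at x) (?at y)}"
    define low where "low = {(x, y) \<in> V \<times> V. (x, y) \<in> E \<and> dens f (?at x) (?at y) < 2 * \<tau>}"
    define D where "D = E \<inter> (irr \<union> low \<union> small \<times> V \<union> V \<times> small)"
    have n: "0 \<le> n" by (simp add: n_def)
    have "real (card small) \<le> 2 ^ card S * (\<eta> * n)"
      unfolding small_def using \<eta> n by (intro card_small_atoms_le V S) simp
    also have "\<dots> \<le> 2 ^ K * (\<eta> * n)"
      using \<eta> n S(2) by (intro mult_right_mono power_increasing) auto
    finally have small: "real (card small) \<le> \<tau> * n" by (simp add: \<eta>_def)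
    have "real (card low) = real (card {(x, y) \<in> V \<times> V. (x, y) \<in> low})"
      by (rule arg_cong[where f = "\<lambda>A. real (card A)"]) (auto simp: low_def)
    also have "\<dots> = (\<Sum>x\<in>V. \<Sum>y\<in>V. of_bool ((x, y) \<in> low))"
      by (rule sum_of_bool_card[OF V V, symmetric])
    also have "\<dots> = (\<Sum>x\<in>V. \<Sum>y\<in>V. of_bool (dens f (?at x) (?at y) < 2 * \<tau>) * f x y)"
      by (intro sum.cong refl) (auto simp: low_def f_def)
    \<comment> \<open>Sparseness is constant on rectangles, so the edges counted there may be
      replaced by the density, which is below \<open>2 * \<tau>\<close>.\<close>
    also have "\<dots> = (\<Sum>x\<in>V. \<Sum>y\<in>V. of_bool (dens f (?at x) (?at y) < 2 * \<tau>) * dens f (?at x) (?at y))"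
      by (rule sum_dens_atoms[OF V, symmetric]) (use dens_atoms_cong in metis)
    also have "\<dots> \<le> (\<Sum>x\<in>V. \<Sum>y\<in>V. 2 * \<tau>)"
      using \<tau> by (intro sum_mono) auto
    also have "\<dots> = 2 * \<tau> * n\<^sup>2" by (simp add: n_def power2_eq_square)
    finally have low: "real (card low) \<le> 2 * \<tau> * n\<^sup>2" .
    have fin: "finite irr" "finite low" "finite small"
      using V by (auto simp: irr_def low_def small_def intro: finite_subset[of _ "V \<times> V"])
    have "card D \<le> card (irr \<union> low \<union> small \<times> V \<union> V \<times> small)"
      unfolding D_def using fin V by (intro card_mono) auto
    also have "\<dots> \<le> card irr + card low + card (small \<times> V) + card (V \<times> small)"
      by (intro order_trans[OF card_Un_le] add_mono order_refl)
    finally have "card D \<le> card irr + card low + 2 * (card small * card V)"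
      by (simp add: card_cartesian_product mult_ac)
    then have "real (card D) \<le> real (card irr + card low + 2 * (card small * card V))"
      by (rule of_nat_mono)
    then have "real (card D) \<le> real (card irr) + real (card low) + 2 * (real (card small) * n)"
      by (simp add: n_def)
    moreover have "real (card irr) \<le> \<tau> * n\<^sup>2"
    proof -
      have "\<tau> ^ 3 \<le> \<tau>" using \<tau> power_decreasing[of 1 3 \<tau>] by simp
      then have "\<tau> ^ 3 * n\<^sup>2 \<le> \<tau> * n\<^sup>2" by (rule mult_right_mono) simp
      then show ?thesis using S(3) by (simp add: irr_def)
    qed
    moreover have "real (card small) * n \<le> \<tau> * n\<^sup>2"
      using mult_right_mono[OF small n] by (simp add: power2_eq_square)
    ultimately have "real (card D) \<le> 5 * \<tau> * n\<^sup>2" using low by simp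
    also have "\<dots> \<le> \<epsilon> * n\<^sup>2" using \<tau> by (intro mult_right_mono) auto
    finally have cardD: "real (card D) \<le> \<epsilon> * n\<^sup>2" .
    have hit: "(x, y) \<in> D \<or> (x, z) \<in> D \<or> (y, z) \<in> D"
      if xyz: "x \<in> V" "y \<in> V" "z \<in> V" and tri: "(x, y) \<in> E" "(x, z) \<in> E" "(y, z) \<in> E" for x y z
    proof (rule ccontr)
      assume neg: "\<not> ?thesis"
      have pair: "\<not> irregular f (\<tau> ^ 3) (?at a) (?at b) \<and> 2 * \<tau> \<le> dens f (?at a) (?at b)
          \<and> \<eta> * n \<le> real (card (?at a)) \<and> \<eta> * n \<le> real (card (?at b))"
        if "a \<in> V" "b \<in> V" "(a, b) \<in> E" "(a, b) \<notin> D" for a b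
        using that by (auto simp: D_def irr_def low_def small_def)
      note p = pair[OF xyz(1,2) tri(1)] pair[OF xyz(1,3) tri(2)] pair[OF xyz(2,3) tri(3)]
      have "\<tau> ^ 3 / 2 * \<eta> ^ 3 * n ^ 3 = \<tau> ^ 3 / 2 * (\<eta> * n) * (\<eta> * n) * (\<eta> * n)"
        by (simp add: power3_eq_cube)
      also have "\<dots> \<le> \<tau> ^ 3 / 2 * real (card (?at x)) * real (card (?at y)) * real (card (?at z))"
        using p neg \<tau> \<eta> n by (intro mult_mono) auto
      also have "\<dots> \<le> real (card {(a, b, c) \<in> ?at x \<times> ?at y \<times> ?at z. (a, b) \<in> E \<and> (a, c) \<in> E \<and> (b, c) \<in> E})"
        using p neg \<tau> self_in_atom[OF xyz(2)] self_in_atom[OF xyz(3)] unfolding f_def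
        by (intro triangle_counting finite_atom V) auto
      also have "\<dots> \<le> real (card {(a, b, c) \<in> V \<times> V \<times> V. (a, b) \<in> E \<and> (a, c) \<in> E \<and> (b, c) \<in> E})"
      proof (intro of_nat_mono card_mono)
        show "finite {(a, b, c) \<in> V \<times> V \<times> V. (a, b) \<in> E \<and> (a, c) \<in> E \<and> (b, c) \<in> E}"
          by (rule finite_subset[of _ "V \<times> V \<times> V"]) (use V in auto)
      qed (use atom_subset[of V S] in blast)
      finally show False using few by (simp add: n_def)
    qed
    show "\<exists>D. D \<subseteq> E \<inter> V \<times> V \<and> real (card D) \<le> \<epsilon> * (real (card V))\<^sup>2 \<and>
       (\<forall>x\<in>V. \<forall>y\<in>V. \<forall>z\<in>V. (x, y) \<in> E \<and> (x, z) \<in> E \<and> (y, z) \<in> E \<longrightarrow>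
          (x, y) \<in> D \<or> (x, z) \<in> D \<or> (y, z) \<in> D)"
    proof (intro exI[of _ D] conjI ballI impI)
      show "D \<subseteq> E \<inter> V \<times> V" by (auto simp: D_def irr_def low_def small_def)
    qed (use cardD hit in \<open>auto simp: n_def\<close>)
  qed
qed

section \<open>Packing triangles in multi-graphs\<close>

text \<open>\<open>w t\<close> is the number of packed triangles on the triple \<open>t\<close>.
  Parallel edges are interchangeable, so \<open>w\<close> comes from an edge-disjoint family exactly
  when no load exceeds the multiplicity of its pair.\<close>

definition load :: "'t set \<Rightarrow> ('t \<Rightarrow> 'e set) \<Rightarrow> ('t \<Rightarrow> nat) \<Rightarrow> 'e \<Rightarrow> nat" where
  "load T sides w e = (\<Sum>t | t \<in> T \<and> e \<in> sides t. w t)"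

lemma load_ge:
  assumes "finite T" "t \<in> T" "e \<in> sides t"
  shows "w t \<le> load T sides w e"
  unfolding load_def using assms by (intro member_le_sum) auto

lemma sum_loads:
  assumes "finite T" "finite P" "\<And>t. t \<in> T \<Longrightarrow> sides t \<subseteq> P"
  shows "(\<Sum>e\<in>P. load T sides w e) = (\<Sum>t\<in>T. card (sides t) * w t)"
proof -
  have "(\<Sum>e\<in>P. load T sides w e) = (\<Sum>t\<in>T. \<Sum>e | e \<in> P \<and> e \<in> sides t. w t)"
    unfolding load_def by (rule sum.swap_restrict[OF assms(2,1)])
  also have "\<dots> = (\<Sum>t\<in>T. card (sides t) * w t)"
  proof (rule sum.cong[OF refl])
    fix t assume "t \<in> T"
    then have "{e. e \<in> P \<and> e \<in> sides t} = sides t" using assms(3) by blast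
    then show "(\<Sum>e | e \<in> P \<and> e \<in> sides t. w t) = card (sides t) * w t" by simp
  qed
  finally show ?thesis .
qed

text \<open>Take a feasible weight of greatest total. If no side of \<open>t\<close> were saturated,
  \<open>w t\<close> could be raised by one.\<close>

lemma maximal_packing:
  fixes c :: "'e \<Rightarrow> nat" and sides :: "'t \<Rightarrow> 'e set"
  assumes T: "finite T" and P: "finite P"
    and sides: "\<And>t. t \<in> T \<Longrightarrow> sides t \<subseteq> P" "\<And>t. t \<in> T \<Longrightarrow> sides t \<noteq> {}"
  obtains w :: "'t \<Rightarrow> nat" where
    "\<forall>e\<in>P. load T sides w e \<le> c e" "\<forall>t\<in>T. \<exists>e\<in>sides t. load T sides w e = c e"
proof -
  define feasible where "feasible w \<longleftrightarrow> (\<forall>e\<in>P. load T sides w e \<le> c e)" for w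
  \<comment> \<open>Since \<open>sides t\<close> is nonempty, every unit of weight uses up capacity,
    so the totals are bounded and a greatest one exists.\<close>
  have bound: "sum w T \<le> sum c P" if "feasible w" for w
  proof -
    have "sum w T \<le> (\<Sum>t\<in>T. card (sides t) * w t)"
    proof (rule sum_mono)
      fix t assume "t \<in> T"
      then have "0 < card (sides t)"
        using sides P by (meson card_gt_0_iff finite_subset)
      then show "w t \<le> card (sides t) * w t" by (cases "card (sides t)") auto
    qed
    also have "\<dots> = (\<Sum>e\<in>P. load T sides w e)"
      by (rule sum_loads[OF T P sides(1), symmetric])
    also have "\<dots> \<le> sum c P"
      using that by (intro sum_mono) (simp add: feasible_def)
    finally show ?thesis .
  qed
  have "feasible (\<lambda>_. 0)" by (simp add: feasible_def load_def)
  moreover have "\<forall>w. feasible w \<longrightarrow> sum w T < Suc (sum c P)"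
    using bound by (simp add: less_Suc_eq_le)
  ultimately have "\<exists>w. feasible w \<and> (\<forall>w'. feasible w' \<longrightarrow> sum w' T \<le> sum w T)"
    by (rule ex_has_greatest_nat[where P = feasible and f = "\<lambda>w. sum w T"])
  then obtain w where w: "feasible w" and max: "\<And>w'. feasible w' \<Longrightarrow> sum w' T \<le> sum w T"
    by blast
  show thesis
  proof (rule that[of w]; (intro ballI)?)
    show "load T sides w e \<le> c e" if "e \<in> P" for e using w that by (simp add: feasible_def)
    fix t assume t: "t \<in> T"
    show "\<exists>e\<in>sides t. load T sides w e = c e"
    proof (rule ccontr)
      assume neg: "\<not> ?thesis"
      define w' where "w' = w(t := w t + 1)"
      have load': "load T sides w' e = load T sides w e + (if e \<in> sides t then 1 else 0)" for e
      proof -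
        let ?A = "{t'. t' \<in> T \<and> e \<in> sides t'}"
        have "load T sides w' e = (\<Sum>t'\<in>?A. w t' + (if t' = t then 1 else 0))"
          unfolding load_def by (intro sum.cong) (auto simp: w'_def)
        then show ?thesis using T t by (simp add: load_def sum.distrib)
      qed
      have "feasible w'"
        unfolding feasible_def
      proof
        fix e assume e: "e \<in> P"
        show "load T sides w' e \<le> c e"
        proof (cases "e \<in> sides t")
          case True
          then have "load T sides w e \<noteq> c e" using neg by blast
          moreover have "load T sides w e \<le> c e" using w e by (simp add: feasible_def)
          ultimately show ?thesis using True by (simp add: load')
        next
          case False
          then show ?thesis using w e by (simp add: load' feasible_def)
        qed
      qed
      moreover have "sum w' T = sum w T + 1"
      proof -
        have "sum w' T = (\<Sum>t'\<in>T. w t' + (if t' = t then 1 else 0))"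
          by (intro sum.cong) (auto simp: w'_def)
        then show ?thesis using T t by (simp add: sum.distrib)
      qed
      ultimately show False using max[of w'] by simp
    qed
  qed
qed

section \<open>Triangle packings of a multi-graph far from triangle-free\<close>

definition vertex_triples :: "nat \<Rightarrow> (nat \<times> nat \<times> nat) set" where
  "vertex_triples n = {(u, v, w). u < v \<and> v < w \<and> w < n}"

definition vertex_pairs :: "nat \<Rightarrow> (nat \<times> nat) set" where
  "vertex_pairs n = {(u, v). u < v \<and> v < n}"

definition sides :: "nat \<times> nat \<times> nat \<Rightarrow> (nat \<times> nat) set" where
  "sides = (\<lambda>(u, v, w). {(u, v), (v, w), (u, w)})"

lemma finite_vertex_triples: "finite (vertex_triples n)"
  by (rule finite_subset[of _ "{..<n} \<times> {..<n} \<times> {..<n}"]) (auto simp: vertex_triples_def)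

lemma finite_vertex_pairs: "finite (vertex_pairs n)"
  by (rule finite_subset[of _ "{..<n} \<times> {..<n}"]) (auto simp: vertex_pairs_def)

lemma sides_subset: "t \<in> vertex_triples n \<Longrightarrow> sides t \<subseteq> vertex_pairs n"
  by (auto simp: vertex_triples_def vertex_pairs_def sides_def)

lemma card_sides: "t \<in> vertex_triples n \<Longrightarrow> card (sides t) = 3"
  by (auto simp: vertex_triples_def sides_def)

lemma finite_sides: "finite (sides t)"
  by (auto simp: sides_def split: prod.splits)

lemma num_triangles_eq:
  "num_triangles n m = (\<Sum>t\<in>vertex_triples n. \<Prod>e\<in>sides t. case_prod m e)"
  unfolding num_triangles_def vertex_triples_def[symmetric]
  by (intro sum.cong) (auto simp: vertex_triples_def sides_def)

definition far_from_triangle_free :: "nat \<Rightarrow> (nat \<Rightarrow> nat \<Rightarrow> nat) \<Rightarrow> bool" where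
  "far_from_triangle_free n m \<longleftrightarrow>
     (\<forall>h. submultigraph n h m \<and> triangle_free n h \<longrightarrow> n ^ 2 \<le> num_removed n m h)"

text \<open>Deleting all edges on the pairs saturated by a maximal packing destroys every triangle.
  The cost is at most the total load, which counts each packed triangle three times.\<close>

lemma triangle_packing:
  assumes far: "far_from_triangle_free n m"
  obtains w where
    "\<forall>e\<in>vertex_pairs n. load (vertex_triples n) sides w e \<le> case_prod m e"
    "n ^ 2 \<le> 3 * sum w (vertex_triples n)"
proof -
  have nonempty: "sides t \<noteq> {}" for t by (auto simp: sides_def split: prod.splits)
  obtain w where le: "\<forall>e\<in>vertex_pairs n. load (vertex_triples n) sides w e \<le> case_prod m e"
    and sat: "\<forall>t\<in>vertex_triples n. \<exists>e\<in>sides t. load (vertex_triples n) sides w e = case_prod m e"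
    by (rule maximal_packing[where c = "case_prod m",
          OF finite_vertex_triples[of n] finite_vertex_pairs[of n] sides_subset nonempty])
  define p where "p = load (vertex_triples n) sides w"
  define h where "h u v = (if p (u, v) = m u v then 0 else m u v)" for u v
  have "triangle_free n h"
    unfolding triangle_free_def
  proof (intro allI impI)
    fix u v x assume "u < v \<and> v < x \<and> x < n"
    then have "(u, v, x) \<in> vertex_triples n" by (simp add: vertex_triples_def)
    from sat[rule_format, OF this] show "h u v = 0 \<or> h v x = 0 \<or> h u x = 0"
      by (auto simp: sides_def h_def p_def)
  qed
  moreover have "submultigraph n h m" by (simp add: submultigraph_def h_def)
  ultimately have "n ^ 2 \<le> num_removed n m h"
    using far by (simp add: far_from_triangle_free_def)
  \<comment> \<open>A saturated pair costs its multiplicity, which equals its load; the other pairs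
    cost nothing.\<close>
  also have "\<dots> \<le> (\<Sum>e\<in>vertex_pairs n. p e)"
    unfolding num_removed_def vertex_pairs_def[symmetric]
    by (intro sum_mono) (auto simp: h_def)
  also have "\<dots> = (\<Sum>t\<in>vertex_triples n. card (sides t) * w t)"
    unfolding p_def by (rule sum_loads[OF finite_vertex_triples finite_vertex_pairs sides_subset])
  also have "\<dots> = 3 * sum w (vertex_triples n)"
    by (simp add: card_sides sum_distrib_left)
  finally show thesis by (rule that[OF le])
qed

lemma le_prod_of_le:
  fixes p :: "'e \<Rightarrow> nat"
  assumes "finite A" "0 < a" "\<And>e. e \<in> A \<Longrightarrow> a \<le> p e" "e \<in> A"
  shows "p e \<le> (\<Prod>e\<in>A. p e)"
proof -
  have "(\<Prod>e\<in>A. p e) = p e * (\<Prod>e\<in>A - {e}. p e)"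
    using assms by (intro prod.remove)
  moreover have "1 \<le> (\<Prod>e\<in>A - {e}. p e)"
    using assms(2,3) by (intro prod_ge_1) force
  ultimately show ?thesis by simp
qed

lemma sum_prod_loads_le:
  assumes "\<forall>e\<in>vertex_pairs n. p e \<le> case_prod m e"
  shows "(\<Sum>t\<in>vertex_triples n. \<Prod>e\<in>sides t. p e) \<le> num_triangles n m"
  unfolding num_triangles_eq
  using assms sides_subset by (intro sum_mono prod_mono) blast

text \<open>A bound valid for every \<open>n\<close>, used to keep the growth function positive. A
  positive \<open>w t\<close> is at most each of its loads, hence at most their product.\<close>

lemma num_triangles_ge_third:
  assumes far: "far_from_triangle_free n m"
  shows "n ^ 2 \<le> 3 * num_triangles n m"
proof -
  obtain w where load_le: "\<forall>e\<in>vertex_pairs n. load (vertex_triples n) sides w e \<le> case_prod m e"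
    and W: "n ^ 2 \<le> 3 * sum w (vertex_triples n)"
    by (rule triangle_packing[OF far])
  define p where "p = load (vertex_triples n) sides w"
  have le: "\<forall>e\<in>vertex_pairs n. p e \<le> case_prod m e" using load_le by (simp add: p_def)
  have "sum w (vertex_triples n) \<le> (\<Sum>t\<in>vertex_triples n. \<Prod>e\<in>sides t. p e)"
  proof (rule sum_mono)
    fix t assume t: "t \<in> vertex_triples n"
    obtain e where e: "e \<in> sides t"
      using card_sides[OF t] by (metis card.empty ex_in_conv zero_neq_numeral)
    show "w t \<le> (\<Prod>e\<in>sides t. p e)"
    proof (cases "w t = 0")
      case False
      have pe: "w t \<le> p e'" if "e' \<in> sides t" for e'
        unfolding p_def by (rule load_ge) (use finite_vertex_triples t that in auto)
      then have "w t \<le> p e" using e .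
      also have "p e \<le> (\<Prod>e\<in>sides t. p e)"
        by (rule le_prod_of_le[of _ "w t"]) (use False finite_sides pe e in auto)
      finally show ?thesis .
    qed simp
  qed
  also have "\<dots> \<le> num_triangles n m" using le by (rule sum_prod_loads_le)
  finally show ?thesis using W by simp
qed

text \<open>A packed triangle whose loads multiply to at most a constant times its own weight has
  bounded loads, because its weight is at most each of the three.\<close>

lemma load_le_of_prod_le:
  fixes p :: "nat \<times> nat \<Rightarrow> nat"
  assumes t: "t \<in> vertex_triples n" and w: "0 < a" "\<And>e. e \<in> sides t \<Longrightarrow> a \<le> p e"
    and prod: "(\<Prod>e\<in>sides t. p e) \<le> c * a" and e: "e \<in> sides t"
  shows "p e \<le> c"
proof -
  have "card (sides t - {e}) = 2" using card_sides[OF t] e finite_sides by simp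
  then obtain e' where e': "e' \<in> sides t - {e}"
    by (metis card.empty ex_in_conv zero_neq_numeral)
  \<comment> \<open>One side \<open>e'\<close> other than \<open>e\<close> supplies a factor of at
    least \<open>a\<close>, while the two remaining sides have product at least
    \<open>p e\<close>.\<close>
  have "p e \<le> (\<Prod>e\<in>sides t - {e'}. p e)"
    using w e e' finite_sides by (intro le_prod_of_le[of _ a]) auto
  then have "p e * a \<le> (\<Prod>e\<in>sides t - {e'}. p e) * p e'"
    using w e' by (intro mult_mono) auto
  also have "\<dots> = (\<Prod>e\<in>sides t. p e)"
    using e' finite_sides[of t] by (simp add: prod.remove[of "sides t" e' p])
  finally have "p e * a \<le> c * a" using prod by (rule order_trans)
  then show ?thesis using w(1) by simp
qed

lemma num_triangles_superquadratic:
  assumes C: "0 < C"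
  shows "\<exists>N. \<forall>n m. N \<le> n \<and> far_from_triangle_free n m \<longrightarrow> C * n ^ 2 \<le> num_triangles n m"
proof -
  \<comment> \<open>36 is 6 times 6: the good triples weigh more than a sixth of
    \<open>n ^ 2\<close>, and each pair used to hit them carries load at most
    \<open>6 * C\<close>.\<close>
  define \<epsilon> where "\<epsilon> = 1 / (36 * real C)"
  have "0 < \<epsilon>" using C by (simp add: \<epsilon>_def)
  from triangle_removal[OF this, where 'a = nat] obtain \<delta> where \<delta>: "0 < \<delta>" and
    removal: "\<forall>(V :: nat set) E. finite V \<and>
       real (card {(x, y, z) \<in> V \<times> V \<times> V. (x, y) \<in> E \<and> (x, z) \<in> E \<and> (y, z) \<in> E})
         < \<delta> * real (card V) ^ 3 \<longrightarrow>
     (\<exists>D. D \<subseteq> E \<inter> V \<times> V \<and> real (card D) \<le> \<epsilon> * (real (card V))\<^sup>2 \<and>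
       (\<forall>x\<in>V. \<forall>y\<in>V. \<forall>z\<in>V. (x, y) \<in> E \<and> (x, z) \<in> E \<and> (y, z) \<in> E \<longrightarrow>
          (x, y) \<in> D \<or> (x, z) \<in> D \<or> (y, z) \<in> D))"
    by (elim exE conjE)
  \<comment> \<open>From this point on, \<open>C * n ^ 2\<close> is at most \<open>\<delta>\<close>
    times the cube of \<open>n\<close>, as the removal lemma requires.\<close>
  obtain N :: nat where N: "real C / \<delta> \<le> real N" using real_arch_simple by blast
  have "C * n ^ 2 \<le> num_triangles n m" if n: "N \<le> n" and far: "far_from_triangle_free n m" for n m
  proof (rule ccontr)
    assume "\<not> ?thesis"
    then have few: "num_triangles n m < C * n ^ 2" by simp
    obtain w where load_le: "\<forall>e\<in>vertex_pairs n. load (vertex_triples n) sides w e \<le> case_prod m e"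
      and W: "n ^ 2 \<le> 3 * sum w (vertex_triples n)"
      by (rule triangle_packing[OF far])
    define p where "p = load (vertex_triples n) sides w"
    have le: "\<forall>e\<in>vertex_pairs n. p e \<le> case_prod m e" using load_le by (simp add: p_def)
    let ?T = "vertex_triples n"
    define good where "good = {t \<in> ?T. 0 < w t \<and> (\<Prod>e\<in>sides t. p e) \<le> 6 * C * w t}"
    have goodT: "good \<subseteq> ?T" by (auto simp: good_def)
    have fin: "finite ?T" "finite good"
      using finite_vertex_triples goodT finite_subset by blast+
    \<comment> \<open>Outside \<open>good\<close> the load product is at least
      \<open>6 * C * w t\<close>, trivially so when \<open>w t\<close> is zero.\<close>
    have "6 * C * sum w (?T - good) \<le> (\<Sum>t\<in>?T - good. \<Prod>e\<in>sides t. p e)"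
      unfolding sum_distrib_left by (intro sum_mono) (auto simp: good_def)
    also have "\<dots> \<le> (\<Sum>t\<in>?T. \<Prod>e\<in>sides t. p e)"
      using fin by (intro sum_mono2) auto
    also have "\<dots> \<le> num_triangles n m" using le by (rule sum_prod_loads_le)
    finally have "6 * C * sum w (?T - good) < C * n ^ 2" using few by (rule le_less_trans)
    then have "C * (6 * sum w (?T - good)) < C * n ^ 2" by (simp only: mult_ac)
    then have "6 * sum w (?T - good) < n ^ 2" by simp
    moreover have "sum w ?T = sum w (?T - good) + sum w good"
      by (rule sum.subset_diff[OF goodT fin(1)])
    ultimately have good_weight: "n ^ 2 < 6 * sum w good" using W by linarith
    define E where "E = {(u, v) \<in> vertex_pairs n. 0 < m u v}"
    define V where "V = {..<n}"
    let ?tri = "{(x, y, z) \<in> V \<times> V \<times> V. (x, y) \<in> E \<and> (x, z) \<in> E \<and> (y, z) \<in> E}"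
    have sub: "?tri \<subseteq> ?T" by (auto simp: E_def vertex_pairs_def vertex_triples_def)
    have "card ?tri = (\<Sum>t\<in>?tri. 1)" by simp
    \<comment> \<open>Each triangle of the underlying simple graph supports at least one triangle of
      the multi-graph.\<close>
    also have "\<dots> \<le> (\<Sum>t\<in>?tri. \<Prod>e\<in>sides t. case_prod m e)"
      by (intro sum_mono prod_ge_1) (auto simp: sides_def E_def Suc_leI)
    also have "\<dots> \<le> num_triangles n m"
      unfolding num_triangles_eq using fin sub by (intro sum_mono2) auto
    finally have "card ?tri < C * n ^ 2" using few by simp
    then have "real (card ?tri) < real (C * n ^ 2)" unfolding of_nat_less_iff .
    also have "\<dots> = real C * real n ^ 2" by simp
    also have "\<dots> \<le> \<delta> * real n * real n ^ 2"
    proof (rule mult_right_mono)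
      have "real C / \<delta> \<le> real n" using N n by linarith
      then show "real C \<le> \<delta> * real n" using \<delta> by (simp add: field_simps)
    qed simp
    also have "\<dots> = \<delta> * real (card V) ^ 3"
      by (simp add: V_def power2_eq_square power3_eq_cube)
    finally obtain D where D: "D \<subseteq> E \<inter> V \<times> V" "real (card D) \<le> \<epsilon> * (real (card V))\<^sup>2"
      and hit: "\<And>x y z. \<lbrakk>x \<in> V; y \<in> V; z \<in> V; (x, y) \<in> E; (x, z) \<in> E; (y, z) \<in> E\<rbrakk>
        \<Longrightarrow> (x, y) \<in> D \<or> (x, z) \<in> D \<or> (y, z) \<in> D"
      using removal[rule_format, of V E] by (auto simp: V_def)
    \<comment> \<open>Pairs of \<open>D\<close> may carry arbitrarily large loads. A good triple has
      only sides of load at most \<open>6 * C\<close>, so the light pairs of \<open>D\<close> still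
      hit all good triples.\<close>
    define D' where "D' = {e \<in> D. p e \<le> 6 * C}"
    have finD: "finite D" using D(1) by (rule finite_subset) (simp add: V_def)
    have finD': "finite D'" using finD by (simp add: D'_def)
    have D'_hit: "\<exists>e\<in>D'. e \<in> sides t" if t: "t \<in> good" for t
    proof -
      have tT: "t \<in> ?T" and wt: "0 < w t" and pr: "(\<Prod>e\<in>sides t. p e) \<le> 6 * C * w t"
        using t by (auto simp: good_def)
      have pe: "w t \<le> p e" if "e \<in> sides t" for e
        unfolding p_def by (rule load_ge) (use finite_vertex_triples tT that in auto)
      obtain x y z where xyz: "t = (x, y, z)" by (metis prod_cases3)
      have "e \<in> E" if "e \<in> sides t" for e
      proof -
        have "e \<in> vertex_pairs n" using sides_subset[OF tT] that by blast
        moreover from this have "0 < case_prod m e" using le pe[OF that] wt by fastforce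
        ultimately show ?thesis by (auto simp: E_def)
      qed
      then have "\<exists>e\<in>D. e \<in> sides t"
        using hit[of x y z] tT by (auto simp: xyz sides_def vertex_triples_def V_def)
      moreover have "p e \<le> 6 * C" if "e \<in> sides t" for e
        using load_le_of_prod_le[OF tT wt pe pr that] .
      ultimately show ?thesis by (auto simp: D'_def)
    qed
    \<comment> \<open>Each good triple is charged to a pair of \<open>D'\<close> among its sides; a
      pair is charged at most its load.\<close>
    have "sum w good \<le> (\<Sum>t\<in>good. \<Sum>e | e \<in> D' \<and> e \<in> sides t. w t)"
    proof (rule sum_mono)
      fix t assume "t \<in> good"
      then obtain e where e: "e \<in> {e. e \<in> D' \<and> e \<in> sides t}" using D'_hit by blast
      have "finite {e. e \<in> D' \<and> e \<in> sides t}" using finD' by simp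
      with e show "w t \<le> (\<Sum>e | e \<in> D' \<and> e \<in> sides t. w t)"
        using member_le_sum[of e "{e. e \<in> D' \<and> e \<in> sides t}" "\<lambda>_. w t"] by simp
    qed
    also have "\<dots> = (\<Sum>e\<in>D'. \<Sum>t | t \<in> good \<and> e \<in> sides t. w t)"
      by (rule sum.swap_restrict[OF fin(2) finD'])
    also have "\<dots> \<le> (\<Sum>e\<in>D'. p e)"
      unfolding p_def load_def using fin goodT by (intro sum_mono sum_mono2) auto
    also have "\<dots> \<le> (\<Sum>e\<in>D'. 6 * C)" by (intro sum_mono) (simp add: D'_def)
    also have "\<dots> \<le> 6 * C * card D"
      using card_mono[OF finD, of D'] by (simp add: D'_def)
    finally have "n ^ 2 < 36 * C * card D" using good_weight by linarith
    then have "real (n ^ 2) < real (36 * C * card D)" unfolding of_nat_less_iff .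
    then have "real n ^ 2 < 36 * real C * real (card D)" by simp
    also have "\<dots> \<le> 36 * real C * (\<epsilon> * real n ^ 2)"
      using D(2) by (intro mult_left_mono) (auto simp: V_def)
    also have "\<dots> = real n ^ 2" using C by (simp add: \<epsilon>_def)
    finally show False by simp
  qed
  then show ?thesis by (intro exI[of _ N] allI impI) (elim conjE)
qed

section \<open>From arbitrary constants to a function tending to infinity\<close>

theorem theorem4:
  shows "\<exists>g :: nat \<Rightarrow> real. (\<forall>n. g n > 0) \<and> filterlim g at_top sequentially \<and>
    (\<forall>n :: nat. \<forall>m :: nat \<Rightarrow> nat \<Rightarrow> nat. n > 0 \<longrightarrow>
       (\<forall>h. submultigraph n h m \<and> triangle_free n h \<longrightarrow> n ^ 2 \<le> num_removed n m h) \<longrightarrow>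
       g n * real n ^ 2 \<le> real (num_triangles n m))"
proof -
  \<comment> \<open>The largest constant valid for \<open>n\<close> serves as the growth rate. The
    cap \<open>C \<le> n\<close> makes the maximum exist: for \<open>n\<close> equal to 1 or 2 no
    multi-graph is far from triangle-free, so every constant would qualify.\<close>
  define A where "A n = {C. C \<le> n \<and> (\<forall>m. far_from_triangle_free n m \<longrightarrow> C * n ^ 2 \<le> num_triangles n m)}" for n
  define g where "g n = max (1 / 3) (real (Max (A n)))" for n
  have finA: "finite (A n)" for n
    by (rule finite_subset[of _ "{..n}"]) (auto simp: A_def)
  have "0 \<in> A n" for n by (simp add: A_def)
  then have MaxA: "Max (A n) \<in> A n" for n using finA by (intro Max_in) auto
  have "filterlim g at_top sequentially"
    unfolding filterlim_at_top
  proof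
    fix Z :: real
    obtain k :: nat where "Z \<le> real k" using real_arch_simple by blast
    define C where "C = Suc k"
    have C: "Z \<le> real C" "0 < C" using \<open>Z \<le> real k\<close> by (simp_all add: C_def)
    obtain N where N: "\<forall>n m. N \<le> n \<and> far_from_triangle_free n m \<longrightarrow> C * n ^ 2 \<le> num_triangles n m"
      using num_triangles_superquadratic[OF C(2)] by blast
    show "\<forall>\<^sub>F n in sequentially. Z \<le> g n"
      \<comment> \<open>\<open>N\<close> makes the constant \<open>C\<close> valid, and
        \<open>n \<ge> C\<close> satisfies the cap in \<open>A n\<close>.\<close>
      using eventually_ge_at_top[of "max N C"]
    proof eventually_elim
      case (elim n)
      then have "C \<in> A n" using N by (simp add: A_def)
      then have "C \<le> Max (A n)" using finA by simp
      then have "real C \<le> g n" by (simp add: g_def)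
      then show ?case using C by simp
    qed
  qed
  moreover have "g n * real n ^ 2 \<le> real (num_triangles n m)" if far: "far_from_triangle_free n m" for n m
  proof -
    have "real (n ^ 2) \<le> real (3 * num_triangles n m)"
      using num_triangles_ge_third[OF far] by (rule of_nat_mono)
    moreover have "real (Max (A n) * n ^ 2) \<le> real (num_triangles n m)"
      using MaxA[of n] far by (intro of_nat_mono) (simp add: A_def)
    ultimately show ?thesis by (simp add: g_def max_def)
  qed
  moreover have "0 < g n" for n by (simp add: g_def)
  ultimately show ?thesis
    unfolding far_from_triangle_free_def by (intro exI[of _ g]) blast
qed

end
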